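(* For any $n\ge3$, $\beta\in T_n$ and $1\le i\le n-1$: (a) $f_{n+1}(\iota^R(\beta)\,t_{n,i})=x^{2i}f_n(\beta)$; (b) $f_{n+1}(\iota^L(\beta)\,t_{1,i})=x^{2i}f_n(\beta)$.
   Context: For $n\ge1$ the twin group $T_n$ is the group with generators $t_1,\dots,t_{n-1}$ and relations $t_i^2=1$ for all $i$ and $t_it_j=t_jt_i$ for $|i-j|>1$ ($T_1$ is trivial). The homomorphisms $\iota^R,\iota^L:T_n\to T_{n+1}$ are given by $\iota^R(t_j)=t_j$ and $\iota^L(t_j)=t_{j+1}$ for $1\le j\le n-1$. For $0\le i\le n-1$ put, in $T_{n+1}$, $$t_{n,i}=t_nt_{n-1}\cdots t_{n-i+1}\,t_{n-i}\,t_{n-i+1}\cdots t_{n-1}t_n,\qquad t_{1,i}=t_1t_2\cdots t_i\,t_{i+1}\,t_i\cdots t_2t_1.$$ Let $\mathbb{Z}(x)$ denote the field of rational functions in $x$ (fraction field of $\mathbb{Z}[x]$). For $n\ge2$ and $1\le i\le n-1$ let $V_i$ be the $(n-1)\times(n-1)$ matrix that agrees with the identity matrix $I_{n-1}$ except in column $i$, where the $(i,i)$ entry is $-1$, the $(i-1,i)$ entry is $x$ (if $i\ge2$), and the $(i+1,i)$ entry is $x$ (if $i\le n-2$). Let $\psi_n:T_n\to GL_{n-1}(\mathbb{Z}(x))$ be the group homomorphism with $\psi_n(t_i)=V_i$. Let $U_m(z)$ be the Chebyshev polynomials of the second kind: $U_0=1$, $U_1=2z$, $U_m=2zU_{m-1}-U_{m-2}$.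 Define $f_n:T_n\to\mathbb{Z}(x)$ by $f_1(1)=1$ and, for $n\ge2$, $$f_n(\beta)=\frac{\det(\psi_n(\beta)-I_{n-1})}{(-x)^{n-1}U_{n-1}\left(\frac1x\right)}.$$ *)

theory Defs
  imports
    "HOL-Algebra.Group"
    "HOL-Computational_Algebra.Polynomial"
    "HOL-Computational_Algebra.Fraction_Field"
    "Jordan_Normal_Form.Determinant"
begin

section \<open>Groups given by generators and relations\<close>

text \<open>Letters are pairs of a generator and a sign; \<open>(g, False)\<close> stands for the formal inverse
  of \<open>g\<close>. The group \<open>\<langle>X | R\<rangle>\<close> consists of the words in \<open>X\<close> modulo the
  smallest congruence that contains \<open>R\<close> and cancels adjacent inverse letters.\<close>

type_synonym 'g word = "('g \<times> bool) list"

definition words :: "'g set \<Rightarrow> 'g word set" where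
  "words X = lists (X \<times> UNIV)"

inductive pres_eq :: "'g set \<Rightarrow> ('g word \<times> 'g word) set \<Rightarrow> 'g word \<Rightarrow> 'g word \<Rightarrow> bool"
  for X R where
  refl: "w \<in> words X \<Longrightarrow> pres_eq X R w w"
| sym: "pres_eq X R u v \<Longrightarrow> pres_eq X R v u"
| trans: "pres_eq X R u v \<Longrightarrow> pres_eq X R v w \<Longrightarrow> pres_eq X R u w"
| app: "pres_eq X R u u' \<Longrightarrow> pres_eq X R v v' \<Longrightarrow> pres_eq X R (u @ v) (u' @ v')"
| cancel: "g \<in> X \<Longrightarrow> pres_eq X R [(g, b), (g, \<not> b)] []"
| rel: "(u, v) \<in> R \<Longrightarrow> u \<in> words X \<Longrightarrow> v \<in> words X \<Longrightarrow> pres_eq X R u v"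

definition pres_class :: "'g set \<Rightarrow> ('g word \<times> 'g word) set \<Rightarrow> 'g word \<Rightarrow> 'g word set" where
  "pres_class X R w = {v. pres_eq X R w v}"

definition pres_group :: "'g set \<Rightarrow> ('g word \<times> 'g word) set \<Rightarrow> 'g word set monoid" where
  "pres_group X R =
    \<lparr>carrier = pres_class X R ` words X,
     mult = (\<lambda>A B. \<Union>u\<in>A. \<Union>v\<in>B. pres_class X R (u @ v)),
     one = pres_class X R []\<rparr>"

definition pres_gen :: "'g set \<Rightarrow> ('g word \<times> 'g word) set \<Rightarrow> 'g \<Rightarrow> 'g word set" where
  "pres_gen X R g = pres_class X R [(g, True)]"

definition eval_word :: "('a, 'b) monoid_scheme \<Rightarrow> ('g \<Rightarrow> 'a) \<Rightarrow> 'g word \<Rightarrow> 'a" where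
  "eval_word G \<phi> w =
    foldr (\<lambda>(g, b) a. (if b then \<phi> g else inv\<^bsub>G\<^esub> (\<phi> g)) \<otimes>\<^bsub>G\<^esub> a) w \<one>\<^bsub>G\<^esub>"

text \<open>The homomorphism into \<open>G\<close> that extends a map \<open>\<phi>\<close> on generators. It is independent of
  the chosen representative when \<open>\<phi>\<close> respects the relations; see \<open>pres_lift_hom\<close> and
  \<open>pres_lift_gen\<close>.\<close>

definition pres_lift :: "('a, 'b) monoid_scheme \<Rightarrow> ('g \<Rightarrow> 'a) \<Rightarrow> 'g word set \<Rightarrow> 'a" where
  "pres_lift G \<phi> A = eval_word G \<phi> (SOME w. w \<in> A)"

lemma words_Nil [simp]: "[] \<in> words X"
  and words_Cons [simp]: "p # w \<in> words X \<longleftrightarrow> fst p \<in> X \<and> w \<in> words X"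
  and words_append [simp]: "u @ v \<in> words X \<longleftrightarrow> u \<in> words X \<and> v \<in> words X"
  by (auto simp: words_def mem_Times_iff)

lemma pres_eq_words: "pres_eq X R u v \<Longrightarrow> u \<in> words X \<and> v \<in> words X"
  by (induction rule: pres_eq.induct) auto

lemma pres_class_eq:
  assumes "u \<in> words X"
  shows "pres_class X R u = pres_class X R v \<longleftrightarrow> pres_eq X R u v"
  using assms unfolding pres_class_def
  by (blast intro: pres_eq.refl pres_eq.sym pres_eq.trans)

lemma pres_group_mult:
  assumes "u \<in> words X" "v \<in> words X"
  shows "pres_class X R u \<otimes>\<^bsub>pres_group X R\<^esub> pres_class X R v = pres_class X R (u @ v)"
  using assms unfolding pres_group_def pres_class_def
  by (auto intro: pres_eq.intros)

lemma pres_group_inv_word: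
  "w \<in> words X \<Longrightarrow> \<exists>v\<in>words X. pres_eq X R (v @ w) []"
proof (induction w)
  case Nil
  then show ?case by (auto intro!: bexI[of _ "[]"] pres_eq.refl)
next
  case (Cons p w)
  obtain g b where p: "p = (g, b)" by (cases p)
  from Cons obtain v where v: "v \<in> words X" "pres_eq X R (v @ w) []" by auto
  have "pres_eq X R (([] :: 'a word) @ w) ([(g, \<not> b), (g, b)] @ w)"
    using Cons.prems p pres_eq.cancel[of g X R "\<not> b"]
    by (intro pres_eq.app) (auto intro: pres_eq.intros)
  then have "pres_eq X R (v @ w) (v @ [(g, \<not> b), (g, b)] @ w)"
    using v by (intro pres_eq.app) (auto intro: pres_eq.intros)
  then have "pres_eq X R ((v @ [(g, \<not> b)]) @ p # w) []"
    using v p by (auto intro: pres_eq.intros)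
  moreover have "v @ [(g, \<not> b)] \<in> words X" using v Cons.prems p by auto
  ultimately show ?case by blast
qed

lemma pres_group_group: "group (pres_group X R)"
proof (rule groupI)
  fix A assume "A \<in> carrier (pres_group X R)"
  then obtain w where w: "w \<in> words X" "A = pres_class X R w" by (auto simp: pres_group_def)
  from pres_group_inv_word[OF w(1)] obtain v where v: "v \<in> words X" "pres_eq X R (v @ w) []" ..
  then have "pres_class X R v \<otimes>\<^bsub>pres_group X R\<^esub> A = \<one>\<^bsub>pres_group X R\<^esub>"
    using w by (simp add: pres_group_mult pres_class_eq) (simp add: pres_group_def pres_class_eq)
  then show "\<exists>B\<in>carrier (pres_group X R). B \<otimes>\<^bsub>pres_group X R\<^esub> A = \<one>\<^bsub>pres_group X R\<^esub>"
    using v by (auto simp: pres_group_def)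
next
  show "\<one>\<^bsub>pres_group X R\<^esub> \<in> carrier (pres_group X R)"
    by (auto simp: pres_group_def)
next
  fix A B assume "A \<in> carrier (pres_group X R)" "B \<in> carrier (pres_group X R)"
  then obtain u v where "u \<in> words X" "A = pres_class X R u" "v \<in> words X" "B = pres_class X R v"
    by (auto simp: pres_group_def)
  then show "A \<otimes>\<^bsub>pres_group X R\<^esub> B \<in> carrier (pres_group X R)"
    by (simp add: pres_group_mult) (simp add: pres_group_def)
next
  fix A B C assume "A \<in> carrier (pres_group X R)" "B \<in> carrier (pres_group X R)"
    "C \<in> carrier (pres_group X R)"
  then obtain u v w where "u \<in> words X" "A = pres_class X R u" "v \<in> words X" "B = pres_class X R v"
    "w \<in> words X" "C = pres_class X R w"
    by (auto simp: pres_group_def)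
  then show "A \<otimes>\<^bsub>pres_group X R\<^esub> B \<otimes>\<^bsub>pres_group X R\<^esub> C =
      A \<otimes>\<^bsub>pres_group X R\<^esub> (B \<otimes>\<^bsub>pres_group X R\<^esub> C)"
    by (simp add: pres_group_mult)
next
  fix A assume "A \<in> carrier (pres_group X R)"
  then obtain u where u: "u \<in> words X" "A = pres_class X R u"
    by (auto simp: pres_group_def)
  have one: "\<one>\<^bsub>pres_group X R\<^esub> = pres_class X R []" by (simp add: pres_group_def)
  show "\<one>\<^bsub>pres_group X R\<^esub> \<otimes>\<^bsub>pres_group X R\<^esub> A = A"
    using u by (simp add: one pres_group_mult)
qed

context group
begin

lemma eval_word_closed:
  "\<lbrakk>\<And>g. g \<in> X \<Longrightarrow> \<phi> g \<in> carrier G; w \<in> words X\<rbrakk> \<Longrightarrow> eval_word G \<phi> w \<in> carrier G"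
  by (induction w) (auto simp: eval_word_def)

lemma eval_word_append:
  assumes "\<And>g. g \<in> X \<Longrightarrow> \<phi> g \<in> carrier G" "u \<in> words X" "v \<in> words X"
  shows "eval_word G \<phi> (u @ v) = eval_word G \<phi> u \<otimes> eval_word G \<phi> v"
  using assms(2)
proof (induction u)
  case Nil
  then show ?case using eval_word_closed[of X \<phi> v] assms by (simp add: eval_word_def)
next
  case (Cons p u)
  obtain g b where p: "p = (g, b)" by (cases p)
  have step: "eval_word G \<phi> ((g, b) # w) = (if b then \<phi> g else inv \<phi> g) \<otimes> eval_word G \<phi> w" for w
    by (simp add: eval_word_def)
  have "\<phi> g \<in> carrier G" using Cons.prems p assms(1) by auto
  then show ?case
    using Cons p eval_word_closed[of X \<phi> u] eval_word_closed[of X \<phi> v] assms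
    by (simp add: step m_assoc)
qed

lemma eval_word_pres_eq:
  assumes "\<And>g. g \<in> X \<Longrightarrow> \<phi> g \<in> carrier G"
    and "\<And>u v. (u, v) \<in> R \<Longrightarrow> u \<in> words X \<Longrightarrow> v \<in> words X \<Longrightarrow> eval_word G \<phi> u = eval_word G \<phi> v"
    and "pres_eq X R u v"
  shows "eval_word G \<phi> u = eval_word G \<phi> v"
  using assms(3)
proof (induction rule: pres_eq.induct)
  case (app u u' v v')
  then show ?case
    using pres_eq_words eval_word_append[of X \<phi>, OF assms(1)] by metis
next
  case (cancel g b)
  then show ?case using assms(1) by (auto simp: eval_word_def)
qed (use assms(2) in auto)

lemma pres_lift_class:
  assumes "\<And>g. g \<in> X \<Longrightarrow> \<phi> g \<in> carrier G"
    and "\<And>u v. (u, v) \<in> R \<Longrightarrow> u \<in> words X \<Longrightarrow> v \<in> words X \<Longrightarrow> eval_word G \<phi> u = eval_word G \<phi> v"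
    and "w \<in> words X"
  shows "pres_lift G \<phi> (pres_class X R w) = eval_word G \<phi> w"
proof -
  have "pres_eq X R w (SOME v. v \<in> pres_class X R w)"
    unfolding pres_class_def mem_Collect_eq by (rule someI) (rule pres_eq.refl[OF assms(3)])
  from eval_word_pres_eq[OF assms(1,2) this] show ?thesis
    by (simp add: pres_lift_def)
qed

lemma pres_lift_hom:
  assumes "\<And>g. g \<in> X \<Longrightarrow> \<phi> g \<in> carrier G"
    and "\<And>u v. (u, v) \<in> R \<Longrightarrow> u \<in> words X \<Longrightarrow> v \<in> words X \<Longrightarrow> eval_word G \<phi> u = eval_word G \<phi> v"
  shows "pres_lift G \<phi> \<in> hom (pres_group X R) G"
proof (rule homI)
  fix A assume "A \<in> carrier (pres_group X R)"
  then obtain u where "u \<in> words X" "A = pres_class X R u" by (auto simp: pres_group_def)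
  then show "pres_lift G \<phi> A \<in> carrier G"
    using pres_lift_class[OF assms] eval_word_closed[OF assms(1)] by simp
next
  fix A B assume "A \<in> carrier (pres_group X R)" "B \<in> carrier (pres_group X R)"
  then obtain u v where "u \<in> words X" "A = pres_class X R u" "v \<in> words X" "B = pres_class X R v"
    by (auto simp: pres_group_def)
  then show "pres_lift G \<phi> (A \<otimes>\<^bsub>pres_group X R\<^esub> B) = pres_lift G \<phi> A \<otimes> pres_lift G \<phi> B"
    using eval_word_append[OF assms(1)]
    by (simp add: pres_group_mult pres_lift_class[OF assms])
qed

lemma pres_lift_gen:
  assumes "\<And>g. g \<in> X \<Longrightarrow> \<phi> g \<in> carrier G"
    and "\<And>u v. (u, v) \<in> R \<Longrightarrow> u \<in> words X \<Longrightarrow> v \<in> words X \<Longrightarrow> eval_word G \<phi> u = eval_word G \<phi> v"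
    and "g \<in> X"
  shows "pres_lift G \<phi> (pres_gen X R g) = \<phi> g"
  using assms(1)[OF assms(3)] assms(3) unfolding pres_gen_def
  by (subst pres_lift_class[OF assms(1,2)]) (auto simp: eval_word_def)

end


section \<open>Twin groups\<close>

definition twin_rels :: "(nat word \<times> nat word) set" where
  "twin_rels =
    {([(i, True), (i, True)], []) | i. True} \<union>
    {([(i, True), (j, True)], [(j, True), (i, True)]) | i j. \<bar>int i - int j\<bar> > 1}"

abbreviation twin_group :: "nat \<Rightarrow> nat word set monoid" where
  "twin_group n \<equiv> pres_group {1..<n} twin_rels"

abbreviation twin_gen :: "nat \<Rightarrow> nat \<Rightarrow> nat word set" where
  "twin_gen n i \<equiv> pres_gen {1..<n} twin_rels i"

definition iotaR :: "nat \<Rightarrow> nat word set \<Rightarrow> nat word set" where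
  "iotaR n = pres_lift (twin_group (n + 1)) (\<lambda>j. twin_gen (n + 1) j)"

definition iotaL :: "nat \<Rightarrow> nat word set \<Rightarrow> nat word set" where
  "iotaL n = pres_lift (twin_group (n + 1)) (\<lambda>j. twin_gen (n + 1) (j + 1))"

definition twin_prod :: "nat \<Rightarrow> nat list \<Rightarrow> nat word set" where
  "twin_prod n js =
    foldr (\<lambda>j g. twin_gen n j \<otimes>\<^bsub>twin_group n\<^esub> g) js \<one>\<^bsub>twin_group n\<^esub>"

text \<open>\<open>twin_R n i\<close> is \<open>t\<^sub>n t\<^sub>n\<^sub>-\<^sub>1 \<dots> t\<^sub>n\<^sub>-\<^sub>i \<dots> t\<^sub>n\<^sub>-\<^sub>1 t\<^sub>n\<close> and
  \<open>twin_L n i\<close> is \<open>t\<^sub>1 t\<^sub>2 \<dots> t\<^sub>i\<^sub>+\<^sub>1 \<dots> t\<^sub>2 t\<^sub>1\<close>, both in \<open>T\<^sub>n\<^sub>+\<^sub>1\<close>.\<close>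

definition twin_R :: "nat \<Rightarrow> nat \<Rightarrow> nat word set" where
  "twin_R n i =
    twin_prod (n + 1) (rev [n - i + 1..<n + 1] @ [n - i] @ [n - i + 1..<n + 1])"

definition twin_L :: "nat \<Rightarrow> nat \<Rightarrow> nat word set" where
  "twin_L n i = twin_prod (n + 1) ([1..<i + 1] @ [i + 1] @ rev [1..<i + 1])"

lemma twin_rels_hold:
  assumes "group G" "\<And>i. i \<in> {1..<n} \<Longrightarrow> \<phi> i \<in> carrier G"
    and "\<And>i. i \<in> {1..<n} \<Longrightarrow> \<phi> i \<otimes>\<^bsub>G\<^esub> \<phi> i = \<one>\<^bsub>G\<^esub>"
    and "\<And>i j. i \<in> {1..<n} \<Longrightarrow> j \<in> {1..<n} \<Longrightarrow> \<bar>int i - int j\<bar> > 1 \<Longrightarrow>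
      \<phi> i \<otimes>\<^bsub>G\<^esub> \<phi> j = \<phi> j \<otimes>\<^bsub>G\<^esub> \<phi> i"
    and "(u, v) \<in> twin_rels" "u \<in> words {1..<n}" "v \<in> words {1..<n}"
  shows "eval_word G \<phi> u = eval_word G \<phi> v"
proof -
  interpret group G by fact
  show ?thesis
    using assms(2-7) by (auto simp: twin_rels_def eval_word_def)
qed

lemma twin_gen_closed: "i \<in> {1..<n} \<Longrightarrow> twin_gen n i \<in> carrier (twin_group n)"
  by (auto simp: pres_group_def pres_gen_def)

lemma twin_gen_sq: "i \<in> {1..<n} \<Longrightarrow> twin_gen n i \<otimes>\<^bsub>twin_group n\<^esub> twin_gen n i = \<one>\<^bsub>twin_group n\<^esub>"
  unfolding pres_gen_def
  by (subst pres_group_mult)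
     (auto simp: pres_group_def pres_class_eq twin_rels_def intro!: pres_eq.rel)

lemma twin_gen_comm:
  "\<lbrakk>i \<in> {1..<n}; j \<in> {1..<n}; \<bar>int i - int j\<bar> > 1\<rbrakk> \<Longrightarrow>
    twin_gen n i \<otimes>\<^bsub>twin_group n\<^esub> twin_gen n j = twin_gen n j \<otimes>\<^bsub>twin_group n\<^esub> twin_gen n i"
  unfolding pres_gen_def
  by (simp add: pres_group_mult pres_class_eq)
     (rule pres_eq.rel, auto simp: twin_rels_def)

lemma iotaR_hom: "iotaR n \<in> hom (twin_group n) (twin_group (n + 1))"
  unfolding iotaR_def
  by (intro group.pres_lift_hom[OF pres_group_group]
      twin_rels_hold[where n = n, OF pres_group_group] twin_gen_closed twin_gen_sq twin_gen_comm) auto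

lemma iotaR_gen: "j \<in> {1..<n} \<Longrightarrow> iotaR n (twin_gen n j) = twin_gen (n + 1) j"
  unfolding iotaR_def
  by (intro group.pres_lift_gen[OF pres_group_group]
      twin_rels_hold[where n = n, OF pres_group_group] twin_gen_closed twin_gen_sq twin_gen_comm) auto

lemma iotaL_hom: "iotaL n \<in> hom (twin_group n) (twin_group (n + 1))"
  unfolding iotaL_def
  by (intro group.pres_lift_hom[OF pres_group_group]
      twin_rels_hold[where n = n, OF pres_group_group] twin_gen_closed twin_gen_sq twin_gen_comm) auto

lemma iotaL_gen: "j \<in> {1..<n} \<Longrightarrow> iotaL n (twin_gen n j) = twin_gen (n + 1) (j + 1)"
  unfolding iotaL_def
  by (intro group.pres_lift_gen[where \<phi> = "\<lambda>j. twin_gen (n + 1) (j + 1)", OF pres_group_group]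
      twin_rels_hold[where n = n, OF pres_group_group] twin_gen_closed twin_gen_sq twin_gen_comm) auto


section \<open>The representation and the invariant\<close>

type_synonym ratfun = "int poly fract"

definition xvar :: ratfun where
  "xvar = Fract [:0, 1:] 1"

definition GL :: "nat \<Rightarrow> ratfun mat monoid" where
  "GL m = units_of (ring_mat TYPE(ratfun) m ())"

text \<open>Matrix entries are indexed from 0, so entry \<open>(r, c)\<close> is the entry in row \<open>r + 1\<close> and
  column \<open>c + 1\<close>.\<close>

definition Vmat :: "nat \<Rightarrow> nat \<Rightarrow> ratfun mat" where
  "Vmat n i = mat (n - 1) (n - 1) (\<lambda>(r, c).
    if c + 1 = i then
      (if r + 1 = i then - 1
       else if r + 1 = i - 1 \<or> r + 1 = i + 1 then xvar
       else 0)
    else if r = c then 1 else 0)"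

definition psi :: "nat \<Rightarrow> nat word set \<Rightarrow> ratfun mat" where
  "psi n = pres_lift (GL (n - 1)) (Vmat n)"

fun cheb_U :: "nat \<Rightarrow> 'a :: comm_ring_1 poly" where
  "cheb_U 0 = 1"
| "cheb_U (Suc 0) = [:0, 2:]"
| "cheb_U (Suc (Suc m)) = [:0, 2:] * cheb_U (Suc m) - cheb_U m"

text \<open>\<open>T\<^sub>1\<close> is trivial, so \<open>f\<^sub>1\<close> is the constant 1.\<close>

definition finv :: "nat \<Rightarrow> nat word set \<Rightarrow> ratfun" where
  "finv n \<beta> =
    (if n = 1 then 1
     else det (psi n \<beta> - 1\<^sub>m (n - 1)) / ((- xvar) ^ (n - 1) * poly (cheb_U (n - 1)) (1 / xvar)))"

lemma GL_group: "group (GL m)"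
proof -
  interpret ring "ring_mat TYPE(ratfun) m ()" by (rule ring_mat)
  show ?thesis unfolding GL_def by (rule units_group)
qed

lemma Vmat_carrier [simp]: "Vmat n i \<in> carrier_mat (n - 1) (n - 1)"
  and Vmat_dim [simp]: "dim_row (Vmat n i) = n - 1" "dim_col (Vmat n i) = n - 1"
  by (simp_all add: Vmat_def)

lemma Vmat_mult_index:
  fixes n i j :: nat
  defines "w \<equiv> \<lambda>i r. if r + 1 = i then - 2 else if r + 1 = i - 1 \<or> r = i then xvar else 0"
  assumes i: "i \<in> {1..<n}" and rc: "r < n - 1" "c < n - 1"
  shows "(Vmat n i * Vmat n j) $$ (r, c) =
    (if r = c then 1 else 0) + (if c + 1 = i then w i r else 0)
    + (if c + 1 = j then w j r + w i r * w j (i - 1) else 0)"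
proof -
  have V: "Vmat n l $$ (a, b) = (if a = b then 1 else 0) + (if b + 1 = l then w l a else 0)"
    if "a < n - 1" "b < n - 1" for l a b
    using that by (auto simp: Vmat_def w_def)
  have "(Vmat n i * Vmat n j) $$ (r, c) = (\<Sum>k<n - 1. Vmat n i $$ (r, k) * Vmat n j $$ (k, c))"
    using rc by (simp add: scalar_prod_def lessThan_atLeast0)
  also have "\<dots> = (\<Sum>k<n - 1.
      (if r = k then (if k = c then 1 else 0) + (if c + 1 = j then w j k else 0) else 0)
      + (if k = i - 1 then w i r * ((if k = c then 1 else 0) + (if c + 1 = j then w j k else 0)) else 0))"
    using rc i by (intro sum.cong) (auto simp: V algebra_simps)
  also have "\<dots> = (if r = c then 1 else 0) + (if c + 1 = j then w j r else 0)
      + w i r * ((if i - 1 = c then 1 else 0) + (if c + 1 = j then w j (i - 1) else 0))"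
    using rc i by (auto simp: sum.distrib)
  also have "\<dots> = (if r = c then 1 else 0) + (if c + 1 = i then w i r else 0)
      + (if c + 1 = j then w j r + w i r * w j (i - 1) else 0)"
    using i by (auto simp: algebra_simps)
  finally show ?thesis .
qed

lemma Vmat_sq: "i \<in> {1..<n} \<Longrightarrow> Vmat n i * Vmat n i = 1\<^sub>m (n - 1)"
  by (rule eq_matI) (auto simp: Vmat_mult_index simp del: index_mult_mat(1))

lemma Vmat_comm:
  assumes "i \<in> {1..<n}" "j \<in> {1..<n}" "\<bar>int i - int j\<bar> > 1"
  shows "Vmat n i * Vmat n j = Vmat n j * Vmat n i"
  using assms by (intro eq_matI) (auto simp: Vmat_mult_index simp del: index_mult_mat(1))

lemma Vmat_GL:
  assumes "i \<in> {1..<n}"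
  shows "Vmat n i \<in> carrier (GL (n - 1))"
  unfolding GL_def units_of_carrier Units_def ring_mat_simps
  using Vmat_sq[OF assms] Vmat_carrier by blast

lemma GL_simps:
  "mult (GL m) = (*)" "one (GL m) = 1\<^sub>m m"
  by (simp_all add: GL_def units_of_mult units_of_one ring_mat_simps)

lemma psi_hom: "psi n \<in> hom (twin_group n) (GL (n - 1))"
  unfolding psi_def
  by (intro group.pres_lift_hom[OF GL_group] twin_rels_hold[where n = n, OF GL_group])
     (simp_all add: Vmat_GL[simplified] GL_simps Vmat_sq Vmat_comm)

lemma psi_gen: "i \<in> {1..<n} \<Longrightarrow> psi n (twin_gen n i) = Vmat n i"
  unfolding psi_def
  by (intro group.pres_lift_gen[OF GL_group] twin_rels_hold[where n = n, OF GL_group])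
     (simp_all add: Vmat_GL[simplified] GL_simps Vmat_sq Vmat_comm)

end

theory Submission
  imports Defs "HOL-Computational_Algebra.Polynomial_Factorial"
begin

text \<open>
  Let \<open>G\<close> be the \<open>m \<times> m\<close> tridiagonal matrix with \<open>- 2\<close> on the diagonal and \<open>x\<close> beside it, a sign-changed
  Cartan matrix. Then \<open>V\<^sub>i = I + G e\<^sub>i e\<^sub>i\<^sup>T\<close>, so every \<open>V\<^sub>i\<close> is a reflection \<open>I + G a a\<^sup>T\<close>, and
  conjugating a reflection with vector \<open>a\<close> by \<open>V\<^sub>i\<close> gives the one with vector \<open>V\<^sub>i\<^sup>T a\<close>
  (\<open>Vmat_conj_reflection\<close>). The elements \<open>t\<^sub>n\<^sub>,\<^sub>i\<close> and \<open>t\<^sub>1\<^sub>,\<^sub>i\<close> are palindromes, so they act on the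
  \<open>n\<close>-dimensional space by such reflections, and each conjugation moves one step along the path
  \<open>1, \<dots>, n\<close> and picks up a factor \<open>x\<close>. Hence the coordinate of \<open>a\<close> at the end that is reached is
  \<open>x\<^sup>i\<close> (\<open>psi_palindrome_up\<close>, \<open>psi_palindrome_down\<close>).

  Products of matrices of the form \<open>I + G X\<close> again have this form. Let \<open>k\<close> be the index of the
  generator missed by \<open>\<iota>\<close>: the last one for \<open>\<iota>\<^sup>R\<close>, the first one for \<open>\<iota>\<^sup>L\<close>. Then the matrix of
  \<open>\<iota>(\<beta>)\<close> is \<open>I + G X\<close>, where row and column \<open>k\<close> of \<open>X\<close> vanish. Since \<open>k\<close> is an end of the path,
  deleting row and column \<open>k\<close> turns \<open>G\<close> into the smaller Cartan matrix \<open>G'\<close>, and the matrix of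
  \<open>\<beta>\<close> is \<open>I + G' X'\<close> with \<open>X'\<close> the corresponding minor of \<open>X\<close> (\<open>stabilised_matrix\<close>). Now
  \<open>(I + G X)(I + G a a\<^sup>T) - I = G (X + v a\<^sup>T)\<close> for \<open>v = a + X G a\<close>,
  with \<open>v\<^sub>k = a\<^sub>k\<close> because row \<open>k\<close> of \<open>X\<close> is zero, and \<open>det (X + v a\<^sup>T) = v\<^sub>k a\<^sub>k det X'\<close>
  (\<open>det_padded_plus_outer\<close>). So the determinant for the product is \<open>a\<^sub>k\<^sup>2 det G det X'\<close>, while the
  one for \<open>\<beta>\<close> is \<open>det G' det X'\<close>. The normalising factors of the invariant are exactly
  \<open>det G\<close> and \<open>det G'\<close> (\<open>det_cartan_cheb\<close>), which are nonzero, and \<open>a\<^sub>k\<^sup>2 = x\<^sup>2\<^sup>i\<close> remains.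

  Vectors are represented as matrices with one column, so that outer products are matrix products.
\<close>

(* Keeps the width 1 of column vectors from being rewritten to Suc 0. *)
declare One_nat_def [simp del]

section \<open>Reflections attached to the Cartan matrix\<close>

definition cartan :: "nat \<Rightarrow> ratfun mat" where
  "cartan m = mat m m (\<lambda>(r, c). if r = c then - 2 else if r = c + 1 \<or> c = r + 1 then xvar else 0)"

definition unit_col :: "nat \<Rightarrow> nat \<Rightarrow> ratfun mat" where
  "unit_col m i = mat m 1 (\<lambda>(r, _). if r = i then 1 else 0)"

definition reflection :: "nat \<Rightarrow> ratfun mat \<Rightarrow> ratfun mat" where
  "reflection m a = 1\<^sub>m m + cartan m * (a * transpose_mat a)"

lemma cartan_carrier [simp]: "cartan m \<in> carrier_mat m m"
  and cartan_dim [simp]: "dim_row (cartan m) = m" "dim_col (cartan m) = m"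
  by (simp_all add: cartan_def)

lemma unit_col_carrier [simp]: "unit_col m i \<in> carrier_mat m 1"
  by (simp add: unit_col_def)

lemma transpose_cartan: "transpose_mat (cartan m) = cartan m"
  by (rule eq_matI) (auto simp: cartan_def)

lemma outer_index:
  assumes "a \<in> carrier_mat m (1::nat)" "b \<in> carrier_mat l 1" "r < m" "c < l"
  shows "(a * transpose_mat b) $$ (r, c) = a $$ (r, 0) * b $$ (c, 0)"
  using assms by (auto simp: scalar_prod_def One_nat_def)

lemma Vmat_reflection_Suc:
  assumes "j < m"
  shows "Vmat (Suc m) (Suc j) = reflection m (unit_col m j)"
proof (rule eq_matI)
  let ?e = "unit_col m j"
  let ?E = "?e * transpose_mat ?e"
  fix r c assume "r < dim_row (reflection m ?e)" "c < dim_col (reflection m ?e)"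
  then have rc: "r < m" "c < m"
    by (auto simp: reflection_def unit_col_def)
  have "(cartan m * ?E) $$ (r, c) = (\<Sum>l = 0..<m. cartan m $$ (r, l) * ?E $$ (l, c))"
    using rc by (simp add: scalar_prod_def unit_col_def)
  also have "\<dots> = (\<Sum>l = 0..<m. if l = j then (if c = j then cartan m $$ (r, j) else 0) else 0)"
  proof (rule sum.cong)
    fix l assume l: "l \<in> {0..<m}"
    then have "?E $$ (l, c) = ?e $$ (l, 0) * ?e $$ (c, 0)"
      using rc by (intro outer_index) auto
    then show "cartan m $$ (r, l) * ?E $$ (l, c)
      = (if l = j then (if c = j then cartan m $$ (r, j) else 0) else 0)"
      using rc l by (simp add: unit_col_def)
  qed simp
  also have "\<dots> = (if c = j then cartan m $$ (r, j) else 0)"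
    using assms by simp
  finally have "reflection m ?e $$ (r, c)
      = (if r = c then 1 else 0) + (if c = j then cartan m $$ (r, j) else 0)"
    using rc by (simp add: reflection_def unit_col_def del: index_mult_mat(1))
  moreover have "Vmat (Suc m) (Suc j) $$ (r, c)
      = (if r = c then 1 else 0) + (if c = j then cartan m $$ (r, j) else 0)"
    using rc by (simp add: Vmat_def cartan_def One_nat_def)
  ultimately show "Vmat (Suc m) (Suc j) $$ (r, c) = reflection m ?e $$ (r, c)"
    by simp
qed (simp_all add: reflection_def unit_col_def)

lemma Vmat_reflection:
  assumes "j \<in> {1..<Suc m}"
  shows "Vmat (Suc m) j = reflection m (unit_col m (j - 1))"
proof -
  have "j - 1 < m" "Suc (j - 1) = j" using assms by auto
  then show ?thesis using Vmat_reflection_Suc[of "j - 1" m] by simp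
qed

lemma reflection_carrier [simp]: "a \<in> carrier_mat m 1 \<Longrightarrow> reflection m a \<in> carrier_mat m m"
  by (auto simp: reflection_def)

text \<open>Reflections preserve the bilinear form with matrix \<open>G\<close>; here both sides equal
  \<open>G + G a a\<^sup>T G\<close>.\<close>

lemma reflection_cartan:
  assumes [simp]: "a \<in> carrier_mat m 1"
  shows "reflection m a * cartan m = cartan m * transpose_mat (reflection m a)"
proof -
  define G where "G = cartan m"
  define P where "P = a * transpose_mat a"
  have G: "G \<in> carrier_mat m m" by (simp add: G_def)
  have P: "P \<in> carrier_mat m m" unfolding P_def by (rule mult_carrier_mat[of _ _ 1]) auto
  have GP: "G * P \<in> carrier_mat m m" and PG: "P * G \<in> carrier_mat m m"
    using mult_carrier_mat[OF G P] mult_carrier_mat[OF P G] by simp_all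
  have "transpose_mat P = P"
    unfolding P_def by (subst transpose_mult[of _ m 1 _ m]) auto
  then have "transpose_mat (G * P) = P * G"
    using transpose_mult[OF G P] by (simp add: G_def transpose_cartan)
  then have "transpose_mat (1\<^sub>m m + G * P) = 1\<^sub>m m + P * G"
    using transpose_add[OF one_carrier_mat GP] by simp
  moreover have "(1\<^sub>m m + G * P) * G = G + G * P * G"
    using add_mult_distrib_mat[OF one_carrier_mat GP G] G by simp
  moreover have "G * (1\<^sub>m m + P * G) = G + G * (P * G)"
    using mult_add_distrib_mat[OF G one_carrier_mat PG] G by simp
  ultimately show ?thesis
    using assoc_mult_mat[OF G P G] by (simp add: reflection_def G_def P_def)
qed

text \<open>By \<open>reflection_cartan\<close>, \<open>V G P V = G V\<^sup>T P V\<close>, and \<open>V\<^sup>T a a\<^sup>T V\<close> is the outer product of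
  \<open>V\<^sup>T a\<close> with itself; the identity part survives because \<open>V\<close> is an involution.\<close>

lemma Vmat_conj_reflection:
  assumes j: "j \<in> {1..<Suc m}" and a: "a \<in> carrier_mat m 1"
  shows "Vmat (Suc m) j * (reflection m a * Vmat (Suc m) j)
    = reflection m (transpose_mat (Vmat (Suc m) j) * a)"
proof -
  define V where "V = Vmat (Suc m) j"
  define G where "G = cartan m"
  define P where "P = a * transpose_mat a"
  have G: "G \<in> carrier_mat m m" by (simp add: G_def)
  have V: "V \<in> carrier_mat m m" using Vmat_carrier[of "Suc m" j] by (simp add: V_def)
  have tV: "transpose_mat V \<in> carrier_mat m m" and ta: "transpose_mat a \<in> carrier_mat 1 m"
    using V a by simp_all
  have P: "P \<in> carrier_mat m m" unfolding P_def by (rule mult_carrier_mat[OF a ta])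
  have GP: "G * P \<in> carrier_mat m m" by (rule mult_carrier_mat[OF G P])
  have PV: "P * V \<in> carrier_mat m m" by (rule mult_carrier_mat[OF P V])
  have VG: "V * G = G * transpose_mat V"
    using reflection_cartan[of "unit_col m (j - 1)" m] Vmat_reflection[OF j] by (simp add: V_def G_def)
  have sq: "V * V = 1\<^sub>m m" using Vmat_sq[OF j] by (simp add: V_def)
  have outer: "transpose_mat V * (P * V) = (transpose_mat V * a) * transpose_mat (transpose_mat V * a)"
  proof -
    have "P * V = a * (transpose_mat a * V)"
      unfolding P_def by (rule assoc_mult_mat[OF a ta V])
    also have "transpose_mat a * V = transpose_mat (transpose_mat V * a)"
      using transpose_mult[OF tV a] by simp
    finally show ?thesis
      using assoc_mult_mat[OF tV a, of "transpose_mat (transpose_mat V * a)" m]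
        mult_carrier_mat[OF tV a] by simp
  qed
  have "(1\<^sub>m m + G * P) * V = V + G * (P * V)"
    using add_mult_distrib_mat[OF one_carrier_mat GP V] assoc_mult_mat[OF G P V] V by simp
  then have "V * ((1\<^sub>m m + G * P) * V) = V * V + V * (G * (P * V))"
    using mult_add_distrib_mat[OF V V mult_carrier_mat[OF G PV]] by simp
  also have "V * (G * (P * V)) = G * (transpose_mat V * (P * V))"
    using assoc_mult_mat[OF V G PV] assoc_mult_mat[OF G tV PV] VG by simp
  finally show ?thesis
    unfolding outer sq by (simp add: reflection_def V_def G_def P_def)
qed

lemma Vmat_transpose_index_other:
  assumes "a \<in> carrier_mat m 1" "r < m" "r + 1 \<noteq> j"
  shows "(transpose_mat (Vmat (Suc m) j) * a) $$ (r, 0) = a $$ (r, 0)"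
proof -
  have "(transpose_mat (Vmat (Suc m) j) * a) $$ (r, 0)
      = (\<Sum>l = 0..<m. Vmat (Suc m) j $$ (l, r) * a $$ (l, 0))"
    using assms by (simp add: scalar_prod_def)
  also have "\<dots> = (\<Sum>l = 0..<m. if l = r then a $$ (r, 0) else 0)"
    using assms by (intro sum.cong) (auto simp: Vmat_def)
  finally show ?thesis using assms by simp
qed

text \<open>Conjugation changes the vector \<open>a\<close> of a reflection only at the index \<open>r\<close> of the conjugating
  generator. When the support of \<open>a\<close> reaches \<open>r\<close> only through one neighbour \<open>p\<close>, the new coordinate
  is \<open>x\<close> times the one at \<open>p\<close>.\<close>

lemma Vmat_transpose_index_new:
  assumes "a \<in> carrier_mat m 1" "r < m" "p < m" "p = r + 1 \<or> r = p + 1"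
    and zero: "\<And>l. \<lbrakk>l < m; l \<noteq> p; l = r \<or> l = r + 1 \<or> r = l + 1\<rbrakk> \<Longrightarrow> a $$ (l, 0) = 0"
  shows "(transpose_mat (Vmat (Suc m) (r + 1)) * a) $$ (r, 0) = xvar * a $$ (p, 0)"
proof -
  have "(transpose_mat (Vmat (Suc m) (r + 1)) * a) $$ (r, 0)
      = (\<Sum>l = 0..<m. Vmat (Suc m) (r + 1) $$ (l, r) * a $$ (l, 0))"
    using assms by (simp add: scalar_prod_def)
  also have "\<dots> = (\<Sum>l = 0..<m. if l = p then xvar * a $$ (p, 0) else 0)"
    using assms(2-4) zero by (intro sum.cong) (auto simp: Vmat_def)
  finally show ?thesis using assms by simp
qed


section \<open>The palindromic elements act as reflections\<close>

lemma psi_carrier: "g \<in> carrier (twin_group n) \<Longrightarrow> psi n g \<in> carrier_mat (n - 1) (n - 1)"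
  using hom_in_carrier[OF psi_hom, of g n]
  by (auto simp: GL_def units_of_carrier Units_def ring_mat_simps)

lemma psi_mult:
  "\<lbrakk>g \<in> carrier (twin_group n); h \<in> carrier (twin_group n)\<rbrakk> \<Longrightarrow>
    psi n (g \<otimes>\<^bsub>twin_group n\<^esub> h) = psi n g * psi n h"
  using hom_mult[OF psi_hom, of g n h] by (simp add: GL_simps)

lemma psi_one: "psi n \<one>\<^bsub>twin_group n\<^esub> = 1\<^sub>m (n - 1)"
  using hom_one[OF psi_hom pres_group_group GL_group, of n] by (simp add: GL_simps)

lemma twin_prod_closed: "set js \<subseteq> {1..<n} \<Longrightarrow> twin_prod n js \<in> carrier (twin_group n)"
proof (induction js)
  case Nil
  then show ?case
    using group.is_monoid[OF pres_group_group] by (auto simp: twin_prod_def monoid.one_closed)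
next
  case (Cons j js)
  then show ?case
    using monoid.m_closed[OF group.is_monoid[OF pres_group_group] twin_gen_closed]
    by (auto simp: twin_prod_def)
qed

lemma psi_twin_prod_Cons:
  assumes "j \<in> {1..<n}" "set js \<subseteq> {1..<n}"
  shows "psi n (twin_prod n (j # js)) = Vmat n j * psi n (twin_prod n js)"
proof -
  have "twin_prod n (j # js) = twin_gen n j \<otimes>\<^bsub>twin_group n\<^esub> twin_prod n js"
    by (simp add: twin_prod_def)
  then show ?thesis
    using psi_mult[OF twin_gen_closed[OF assms(1)] twin_prod_closed[OF assms(2)]] psi_gen[OF assms(1)]
    by simp
qed

lemma psi_twin_prod_snoc:
  assumes "j \<in> {1..<n}" "set js \<subseteq> {1..<n}"
  shows "psi n (twin_prod n (js @ [j])) = psi n (twin_prod n js) * Vmat n j"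
  using assms(2)
proof (induction js)
  case Nil
  have "psi n (twin_prod n []) = 1\<^sub>m (n - 1)" by (simp add: twin_prod_def psi_one)
  then show ?case
    using psi_twin_prod_Cons[OF assms(1), of "[]"] by simp
next
  case (Cons i js)
  then show ?case
    using assms(1) psi_carrier[OF twin_prod_closed[of js n]]
    by (simp add: psi_twin_prod_Cons assoc_mult_mat[of _ "n - 1" "n - 1" _ "n - 1" _ "n - 1"])
qed

lemma psi_twin_prod_conj:
  assumes j: "j \<in> {1..<Suc m}" and js: "set js \<subseteq> {1..<Suc m}"
    and "a \<in> carrier_mat m 1" and "psi (Suc m) (twin_prod (Suc m) js) = reflection m a"
  shows "psi (Suc m) (twin_prod (Suc m) (j # js @ [j]))
    = reflection m (transpose_mat (Vmat (Suc m) j) * a)"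
proof -
  have "psi (Suc m) (twin_prod (Suc m) (j # js @ [j]))
      = Vmat (Suc m) j * (psi (Suc m) (twin_prod (Suc m) js) * Vmat (Suc m) j)"
    using psi_twin_prod_Cons[OF j, of "js @ [j]"] psi_twin_prod_snoc[OF j js] j js by simp
  then show ?thesis
    using assms(3,4) Vmat_conj_reflection[OF j] by simp
qed

lemma psi_twin_prod_single:
  assumes "j \<in> {1..<Suc m}"
  shows "psi (Suc m) (twin_prod (Suc m) [j]) = reflection m (unit_col m (j - 1))"
proof -
  have "psi (Suc m) (twin_prod (Suc m) [j]) = Vmat (Suc m) j * 1\<^sub>m m"
    using psi_twin_prod_Cons[OF assms, of "[]"] by (simp add: twin_prod_def psi_one)
  also have "\<dots> = Vmat (Suc m) j"
    using Vmat_carrier[of "Suc m" j] by (intro right_mult_one_mat) simp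
  finally show ?thesis using Vmat_reflection[OF assms] by simp
qed

text \<open>Each further conjugating generator lies just beyond the support of \<open>a\<close>, so it extends the
  support by one index and multiplies the outermost coordinate by \<open>x\<close>. Only that coordinate matters,
  together with the zeros beyond it, which carry the induction.\<close>

lemma psi_palindrome_up:
  assumes "p + d < m"
  shows "\<exists>a \<in> carrier_mat m 1.
    psi (Suc m) (twin_prod (Suc m) (rev [p + 2..<p + d + 2] @ [p + 1] @ [p + 2..<p + d + 2])) = reflection m a
    \<and> a $$ (p + d, 0) = xvar ^ d \<and> (\<forall>l. p + d < l \<and> l < m \<longrightarrow> a $$ (l, 0) = 0)"
  using assms
proof (induction d)
  case 0
  then show ?case
    using psi_twin_prod_single[of "p + 1" m]
    by (intro bexI[of _ "unit_col m p"]) (auto simp: unit_col_def)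
next
  case (Suc d)
  let ?js = "rev [p + 2..<p + d + 2] @ [p + 1] @ [p + 2..<p + d + 2]" and ?j = "p + d + 2"
  from Suc obtain a where a: "a \<in> carrier_mat m 1"
    "psi (Suc m) (twin_prod (Suc m) ?js) = reflection m a" "a $$ (p + d, 0) = xvar ^ d"
    "\<And>l. p + d < l \<Longrightarrow> l < m \<Longrightarrow> a $$ (l, 0) = 0"
    by auto
  define b where "b = transpose_mat (Vmat (Suc m) ?j) * a"
  have j: "?j \<in> {1..<Suc m}" using Suc.prems by simp
  have "psi (Suc m) (twin_prod (Suc m) (?j # ?js @ [?j])) = reflection m b"
    unfolding b_def using Suc.prems a by (intro psi_twin_prod_conj) auto
  moreover have "?j # ?js @ [?j] = rev [p + 2..<p + Suc d + 2] @ [p + 1] @ [p + 2..<p + Suc d + 2]"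
    by simp
  moreover have "b \<in> carrier_mat m 1"
    unfolding b_def using a(1) Vmat_carrier[of "Suc m" ?j] by (auto intro!: mult_carrier_mat)
  moreover have "b $$ (p + Suc d, 0) = xvar ^ Suc d"
  proof -
    have "(transpose_mat (Vmat (Suc m) (p + Suc d + 1)) * a) $$ (p + Suc d, 0) = xvar * a $$ (p + d, 0)"
      using a(4) Suc.prems by (intro Vmat_transpose_index_new[OF a(1)]) auto
    then show ?thesis using a(3) by (simp add: b_def One_nat_def)
  qed
  moreover have "b $$ (l, 0) = 0" if "p + Suc d < l" "l < m" for l
    using Vmat_transpose_index_other[OF a(1), of l ?j] a(4)[of l] that by (auto simp: b_def)
  ultimately show ?case by (intro bexI[of _ b]) auto
qed

text \<open>The same argument with the support growing towards index 0.\<close>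

lemma psi_palindrome_down:
  assumes "p < m" "d \<le> p"
  shows "\<exists>a \<in> carrier_mat m 1.
    psi (Suc m) (twin_prod (Suc m) ([p - d + 1..<p + 1] @ [p + 1] @ rev [p - d + 1..<p + 1])) = reflection m a
    \<and> a $$ (p - d, 0) = xvar ^ d \<and> (\<forall>l. l < p - d \<longrightarrow> a $$ (l, 0) = 0)"
  using assms(2)
proof (induction d)
  case 0
  then show ?case
    using psi_twin_prod_single[of "p + 1" m] assms
    by (intro bexI[of _ "unit_col m p"]) (auto simp: unit_col_def)
next
  case (Suc d)
  let ?js = "[p - d + 1..<p + 1] @ [p + 1] @ rev [p - d + 1..<p + 1]" and ?j = "p - Suc d + 1"
  from Suc obtain a where a: "a \<in> carrier_mat m 1"
    "psi (Suc m) (twin_prod (Suc m) ?js) = reflection m a" "a $$ (p - d, 0) = xvar ^ d"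
    "\<And>l. l < p - d \<Longrightarrow> a $$ (l, 0) = 0"
    by auto
  define b where "b = transpose_mat (Vmat (Suc m) ?j) * a"
  have j: "?j \<in> {1..<Suc m}" using Suc.prems assms by (simp add: One_nat_def Suc_le_eq)
  have "psi (Suc m) (twin_prod (Suc m) (?j # ?js @ [?j])) = reflection m b"
    unfolding b_def
  proof (rule psi_twin_prod_conj[OF j _ a(1,2)])
    show "set ?js \<subseteq> {1..<Suc m}" using Suc.prems assms by auto
  qed
  moreover have "[?j..<p + 1] = ?j # [p - d + 1..<p + 1]"
  proof -
    have "p - Suc d + 1 < p + 1" "Suc (p - Suc d + 1) = p - d + 1" using Suc.prems by auto
    then show ?thesis by (metis upt_conv_Cons)
  qed
  then have "?j # ?js @ [?j] = [?j..<p + 1] @ [p + 1] @ rev [?j..<p + 1]"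
    by simp
  moreover have "b \<in> carrier_mat m 1"
    unfolding b_def using a(1) Vmat_carrier[of "Suc m" ?j] by (auto intro!: mult_carrier_mat)
  moreover have "b $$ (p - Suc d, 0) = xvar ^ Suc d"
  proof -
    have "b $$ (p - Suc d, 0) = xvar * a $$ (p - d, 0)"
      unfolding b_def using a(4) Suc.prems assms
      by (intro Vmat_transpose_index_new[OF a(1), of "p - Suc d" "p - d"]) auto
    then show ?thesis using a(3) by simp
  qed
  moreover have "b $$ (l, 0) = 0" if "l < p - Suc d" for l
    using Vmat_transpose_index_other[OF a(1), of l ?j] a(4)[of l] that assms by (auto simp: b_def)
  ultimately show ?case by (intro bexI[of _ b]) auto
qed


section \<open>Determinants and deletion of a diagonal index\<close>

lemma mat_delete_diag_index:
  assumes "A \<in> carrier_mat (Suc m) (Suc m)" "k < Suc m" "r < m" "c < m"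
  shows "mat_delete A k k $$ (r, c) = A $$ (insert_index k r, insert_index k c)"
  using assms by (auto simp: mat_delete_def insert_index_def)

lemma sum_insert_index:
  fixes f :: "nat \<Rightarrow> 'a :: comm_monoid_add"
  assumes "k \<le> m"
  shows "sum f {0..<Suc m} = f k + (\<Sum>l = 0..<m. f (insert_index k l))"
proof -
  have "bij_betw (insert_index k) {0..<m} ({0..<Suc m} - {k})"
    using assms insert_index_image[of k m] insert_index_inj_on[of k "{0..<m}"]
    by (auto simp: bij_betw_def)
  then have "(\<Sum>l = 0..<m. f (insert_index k l)) = sum f ({0..<Suc m} - {k})"
    by (rule sum.reindex_bij_betw)
  then show ?thesis using assms by (simp add: sum.remove[of _ k] del: sum.atLeast0_lessThan_Suc sum.op_ivl_Suc)
qed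

lemma mult_index_zero_row:
  fixes A B :: "'a :: semiring_0 mat"
  assumes "A \<in> carrier_mat m n" "B \<in> carrier_mat n p" "r < m" "c < p"
    and "\<And>l. l < n \<Longrightarrow> A $$ (r, l) = 0"
  shows "(A * B) $$ (r, c) = 0"
  using assms by (auto simp: scalar_prod_def intro!: sum.neutral)

lemma mult_index_zero_column:
  fixes A B :: "'a :: semiring_0 mat"
  assumes "A \<in> carrier_mat m n" "B \<in> carrier_mat n p" "r < m" "c < p"
    and "\<And>l. l < n \<Longrightarrow> B $$ (l, c) = 0"
  shows "(A * B) $$ (r, c) = 0"
  using assms by (auto simp: scalar_prod_def intro!: sum.neutral)

text \<open>The term that deletion removes from each scalar product is the one excluded by the last
  hypothesis.\<close>

lemma mat_delete_mult:
  fixes A B :: "'a :: comm_ring_1 mat"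
  assumes A: "A \<in> carrier_mat (Suc m) (Suc m)" and B: "B \<in> carrier_mat (Suc m) (Suc m)"
    and k: "k < Suc m"
    and zero: "\<And>r c. \<lbrakk>r < Suc m; r \<noteq> k; c < Suc m; c \<noteq> k\<rbrakk> \<Longrightarrow> A $$ (r, k) * B $$ (k, c) = 0"
  shows "mat_delete (A * B) k k = mat_delete A k k * mat_delete B k k"
proof (rule eq_matI)
  fix r c assume "r < dim_row (mat_delete A k k * mat_delete B k k)"
    "c < dim_col (mat_delete A k k * mat_delete B k k)"
  then have rc: "r < m" "c < m" using A B by auto
  let ?i = "insert_index k"
  have i: "?i r < Suc m" "?i c < Suc m" "?i r \<noteq> k" "?i c \<noteq> k"
    using rc by (auto simp: insert_index_def)
  have "mat_delete (A * B) k k $$ (r, c) = (\<Sum>l = 0..<Suc m. A $$ (?i r, l) * B $$ (l, ?i c))"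
    using A B rc i k by (subst mat_delete_diag_index[of _ m]) (auto simp: scalar_prod_def)
  also have "\<dots> = (\<Sum>l = 0..<m. A $$ (?i r, ?i l) * B $$ (?i l, ?i c))"
    using k zero[OF i(1,3,2,4)] by (subst sum_insert_index[of k]) auto
  also have "\<dots> = (\<Sum>l = 0..<m. mat_delete A k k $$ (r, l) * mat_delete B k k $$ (l, c))"
    using A B k rc by (intro sum.cong) (auto simp: mat_delete_diag_index[of _ m])
  finally show "mat_delete (A * B) k k $$ (r, c) = (mat_delete A k k * mat_delete B k k) $$ (r, c)"
    using A B rc by (simp add: scalar_prod_def)
qed (use A B in auto)

lemma mat_delete_one: "k < Suc m \<Longrightarrow> mat_delete (1\<^sub>m (Suc m)) k k = 1\<^sub>m m"
  by (rule eq_matI) (auto simp: mat_delete_def)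

lemma mat_delete_one_plus:
  fixes Z :: "'a :: ring_1 mat"
  assumes "Z \<in> carrier_mat (Suc m) (Suc m)" "k < Suc m"
  shows "mat_delete (1\<^sub>m (Suc m) + Z) k k - 1\<^sub>m m = mat_delete Z k k"
  using assms by (intro eq_matI) (auto simp: mat_delete_def)

lemma det_isolated_row:
  fixes A :: "'a :: comm_ring_1 mat"
  assumes A: "A \<in> carrier_mat (Suc m) (Suc m)" and k: "k < Suc m"
    and zero: "\<And>c. c < Suc m \<Longrightarrow> c \<noteq> k \<Longrightarrow> A $$ (k, c) = 0"
  shows "det A = A $$ (k, k) * det (mat_delete A k k)"
proof -
  have "det A = (\<Sum>c<Suc m. A $$ (k, c) * cofactor A k c)"
    by (rule laplace_expansion_row[OF A k])
  also have "\<dots> = (\<Sum>c<Suc m. if c = k then A $$ (k, k) * cofactor A k k else 0)"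
    using zero by (intro sum.cong) auto
  finally show ?thesis using k by (simp add: cofactor_def)
qed

lemma det_isolated_column:
  fixes A :: "'a :: comm_ring_1 mat"
  assumes A: "A \<in> carrier_mat (Suc m) (Suc m)" and k: "k < Suc m"
    and zero: "\<And>r. r < Suc m \<Longrightarrow> r \<noteq> k \<Longrightarrow> A $$ (r, k) = 0"
  shows "det A = A $$ (k, k) * det (mat_delete A k k)"
proof -
  have "det A = (\<Sum>r<Suc m. A $$ (r, k) * cofactor A r k)"
    by (rule laplace_expansion_column[OF A k])
  also have "\<dots> = (\<Sum>r<Suc m. if r = k then A $$ (k, k) * cofactor A k k else 0)"
    using zero by (intro sum.cong) auto
  finally show ?thesis using k by (simp add: cofactor_def)
qed

text \<open>As row and column \<open>k\<close> of \<open>X\<close> vanish, \<open>X + v a\<^sup>T\<close> factors as the identity with column \<open>k\<close>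
  replaced by \<open>v\<close>, times \<open>X\<close> with row \<open>k\<close> replaced by \<open>a\<^sup>T\<close>. Each factor has a row or a column
  whose only possibly nonzero entry is at \<open>(k, k)\<close>.\<close>

lemma det_padded_plus_outer:
  fixes X v a :: "'a :: comm_ring_1 mat"
  assumes X: "X \<in> carrier_mat (Suc m) (Suc m)" and v: "v \<in> carrier_mat (Suc m) 1"
    and a: "a \<in> carrier_mat (Suc m) 1" and k: "k < Suc m"
    and row: "\<And>c. c < Suc m \<Longrightarrow> X $$ (k, c) = 0" and col: "\<And>r. r < Suc m \<Longrightarrow> X $$ (r, k) = 0"
  shows "det (X + v * transpose_mat a) = v $$ (k, 0) * a $$ (k, 0) * det (mat_delete X k k)"
proof -
  define L where "L = mat (Suc m) (Suc m) (\<lambda>(r, c). if c = k then v $$ (r, 0) else if r = c then 1 else 0)"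
  define M where "M = mat (Suc m) (Suc m) (\<lambda>(r, c). if r = k then a $$ (c, 0) else X $$ (r, c))"
  have L: "L \<in> carrier_mat (Suc m) (Suc m)" and M: "M \<in> carrier_mat (Suc m) (Suc m)"
    by (simp_all add: L_def M_def)
  have "X + v * transpose_mat a = L * M"
  proof (rule eq_matI)
    fix r c assume "r < dim_row (L * M)" "c < dim_col (L * M)"
    then have rc: "r < Suc m" "c < Suc m" using L M by auto
    have "(L * M) $$ (r, c) = (\<Sum>l = 0..<Suc m. L $$ (r, l) * M $$ (l, c))"
      using L M rc by (simp add: scalar_prod_def)
    also have "\<dots> = (\<Sum>l = 0..<Suc m. (if l = k then v $$ (r, 0) * a $$ (c, 0) else 0)
        + (if l = r then X $$ (r, c) else 0))"
      using rc k row by (intro sum.cong) (auto simp: L_def M_def)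
    also have "\<dots> = v $$ (r, 0) * a $$ (c, 0) + X $$ (r, c)"
      using rc k by (subst sum.distrib) simp
    finally show "(X + v * transpose_mat a) $$ (r, c) = (L * M) $$ (r, c)"
      using X v a rc outer_index[OF v a rc] by (simp add: add.commute)
  qed (use L M X v a in auto)
  then have "det (X + v * transpose_mat a) = det L * det M"
    using det_mult[OF L M] by simp
  also have "det L = v $$ (k, 0)"
  proof -
    have "mat_delete L k k = 1\<^sub>m m"
      using k by (intro eq_matI) (auto simp: mat_delete_def L_def)
    then show ?thesis
      using det_isolated_row[OF L k] k by (simp add: L_def)
  qed
  also have "det M = a $$ (k, 0) * det (mat_delete X k k)"
  proof -
    have "mat_delete M k k = mat_delete X k k"
      using X k by (intro eq_matI) (auto simp: mat_delete_def M_def)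
    then show ?thesis
      using det_isolated_column[OF M k] k col by (simp add: M_def)
  qed
  finally show ?thesis by (simp add: mult.assoc)
qed


section \<open>The Cartan determinant\<close>

text \<open>Deleting an end of the path leaves a path; an inner index would disconnect it.\<close>

lemma mat_delete_cartan:
  assumes "k = 0 \<or> k = m"
  shows "mat_delete (cartan (Suc m)) k k = cartan m"
  using assms by (intro eq_matI) (auto simp: mat_delete_def cartan_def)

lemma det_cartan_0: "det (cartan 0) = 1"
  by (rule det_dim_zero) simp

lemma det_cartan_1: "det (cartan (Suc 0)) = - 2"
  by (subst det_single) (auto simp: cartan_def)

lemma det_cartan_rec:
  "det (cartan (Suc (Suc m))) = - 2 * det (cartan (Suc m)) - xvar\<^sup>2 * det (cartan m)"
proof -
  let ?C = "cartan (Suc (Suc m))"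
  define B where "B = mat_delete ?C 0 1"
  have B: "B \<in> carrier_mat (Suc m) (Suc m)" by (simp add: B_def mat_delete_def)
  have "det ?C = (\<Sum>c<Suc (Suc m). ?C $$ (0, c) * cofactor ?C 0 c)"
    by (rule laplace_expansion_row) simp_all
  also have "\<dots> = ?C $$ (0, 0) * cofactor ?C 0 0 + ?C $$ (0, 1) * cofactor ?C 0 1
      + (\<Sum>c<m. ?C $$ (0, Suc (Suc c)) * cofactor ?C 0 (Suc (Suc c)))"
    by (simp add: sum.lessThan_Suc_shift One_nat_def del: sum.lessThan_Suc)
  also have "\<dots> = ?C $$ (0, 0) * cofactor ?C 0 0 + ?C $$ (0, 1) * cofactor ?C 0 1"
    by (simp add: cartan_def)
  also have "\<dots> = - 2 * det (cartan (Suc m)) - xvar * det B"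
    using mat_delete_cartan[of 0 "Suc m"] by (simp add: cofactor_def cartan_def[of "Suc (Suc m)"] B_def)
  also have "det B = xvar * det (cartan m)"
  proof -
    have "mat_delete B 0 0 = cartan m"
      by (intro eq_matI) (auto simp: B_def mat_delete_def cartan_def)
    moreover have "B $$ (0, 0) = xvar"
      by (simp add: B_def mat_delete_def cartan_def)
    moreover have "B $$ (r, 0) = 0" if "r < Suc m" "r \<noteq> 0" for r
      using that by (simp add: B_def mat_delete_def cartan_def)
    ultimately show ?thesis using det_isolated_column[OF B, of 0] by simp
  qed
  finally show ?thesis by (simp add: power2_eq_square)
qed

lemma xvar_to_fract: "xvar = to_fract [:0, 1:]"
  by (simp add: xvar_def to_fract_def)

lemma xvar_nonzero: "xvar \<noteq> 0"
  by (simp add: xvar_to_fract)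

text \<open>The recursion \<open>D\<^sub>m\<^sub>+\<^sub>2 = - 2 D\<^sub>m\<^sub>+\<^sub>1 - x\<^sup>2 D\<^sub>m\<close> is the Chebyshev recursion at \<open>1/x\<close>, scaled by
  \<open>(- x)\<^sup>m\<close>.\<close>

lemma det_cartan_cheb: "det (cartan m) = (- xvar) ^ m * poly (cheb_U m) (1 / xvar)"
proof (induction m rule: cheb_U.induct)
  case (3 m)
  let ?u = "\<lambda>m. poly (cheb_U m) (1 / xvar)"
  have "?u (Suc (Suc m)) = 2 / xvar * ?u (Suc m) - ?u m"
    by simp
  then have "(- xvar) ^ Suc (Suc m) * ?u (Suc (Suc m))
      = xvar * (2 / xvar) * (- ((- xvar) ^ Suc m * ?u (Suc m))) - xvar\<^sup>2 * ((- xvar) ^ m * ?u m)"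
    by (simp add: algebra_simps power2_eq_square)
  also have "xvar * (2 / xvar) = 2"
    using xvar_nonzero by simp
  finally show ?case
    using 3 by (simp add: det_cartan_rec del: power_Suc)
qed (use xvar_nonzero in \<open>simp_all add: det_cartan_0 det_cartan_1\<close>)

text \<open>The determinant is a polynomial in \<open>x\<close>, and at \<open>x = 0\<close> it is that of \<open>- 2 I\<close>.\<close>

lemma det_cartan_nonzero: "det (cartan m) \<noteq> 0"
proof -
  have "\<exists>p. det (cartan m) = to_fract p \<and> coeff p 0 = (- 2) ^ m"
  proof (induction m rule: cheb_U.induct)
    case 1
    show ?case by (intro exI[of _ 1]) (simp add: det_cartan_0)
  next
    case 2
    (* - 2 is written as a sum of ones, which the embedding preserves as a ring homomorphism. *)
    have "to_fract (- (1 + 1)) = - (1 + 1 :: ratfun)"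
      by (simp only: to_fract_uminus to_fract_add to_fract_1)
    moreover have "coeff (- (1 + 1) :: int poly) 0 = - 2"
      by (simp only: coeff_minus coeff_add) simp
    ultimately show ?case by (intro exI[of _ "- (1 + 1)"]) (simp only: det_cartan_1 power_Suc power_0, simp)
  next
    case (3 m)
    then obtain p q where p: "det (cartan (Suc m)) = to_fract p" "coeff p 0 = (- 2) ^ Suc m"
      and q: "det (cartan m) = to_fract q" "coeff q 0 = (- 2) ^ m" by auto
    let ?s = "- (p + p) - [:0, 1:] * ([:0, 1:] * q)"
    have "det (cartan (Suc (Suc m))) = to_fract ?s"
      unfolding det_cartan_rec p q xvar_to_fract
      by (simp only: to_fract_uminus to_fract_add to_fract_diff to_fract_mult power2_eq_square
          mult.assoc mult_minus_left mult_2)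
    moreover have "coeff ?s 0 = (- 2) ^ Suc (Suc m)"
      by (simp only: coeff_diff coeff_minus coeff_add p(2)) (simp add: coeff_mult)
    ultimately show ?case by blast
  qed
  then show ?thesis by auto
qed


section \<open>Behaviour of the representation and the invariant under stabilisation\<close>

text \<open>Positive letters suffice because every generator is its own inverse.\<close>

lemma twin_group_induct [consumes 1, case_names one gen]:
  assumes "\<beta> \<in> carrier (twin_group n)"
    and one: "P \<one>\<^bsub>twin_group n\<^esub>"
    and gen: "\<And>j g. \<lbrakk>j \<in> {1..<n}; g \<in> carrier (twin_group n); P g\<rbrakk> \<Longrightarrow> P (twin_gen n j \<otimes>\<^bsub>twin_group n\<^esub> g)"
  shows "P \<beta>"
proof -
  let ?X = "{1..<n}"
  have "P (pres_class ?X twin_rels w)" if "w \<in> words ?X" for w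
    using that
  proof (induction w)
    case Nil
    then show ?case using one by (simp add: pres_group_def)
  next
    case (Cons p w)
    obtain j b where p: "p = (j, b)" by (cases p)
    have j: "j \<in> ?X" and w: "w \<in> words ?X" using Cons.prems p by auto
    have "pres_eq ?X twin_rels [(j, b)] [(j, True)]"
    proof (cases b)
      case False
      have sq: "pres_eq ?X twin_rels [] ([(j, True), (j, True)])"
        using j by (intro pres_eq.sym[OF pres_eq.rel]) (auto simp: twin_rels_def)
      have "pres_eq ?X twin_rels ([(j, False)] @ []) ([(j, False)] @ [(j, True), (j, True)])"
        using j sq by (intro pres_eq.app pres_eq.refl) auto
      moreover have "pres_eq ?X twin_rels ([(j, False), (j, True)] @ [(j, True)]) ([] @ [(j, True)])"
        using pres_eq.cancel[OF j, of twin_rels False] j by (intro pres_eq.app pres_eq.refl) auto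
      ultimately show ?thesis using False pres_eq.trans by fastforce
    qed (use j in \<open>auto intro: pres_eq.refl\<close>)
    then have "pres_eq ?X twin_rels ([(j, b)] @ w) ([(j, True)] @ w)"
      using w by (intro pres_eq.app pres_eq.refl)
    then have "pres_class ?X twin_rels (p # w) = pres_class ?X twin_rels ([(j, True)] @ w)"
      using Cons.prems p by (subst pres_class_eq) auto
    also have "\<dots> = twin_gen n j \<otimes>\<^bsub>twin_group n\<^esub> pres_class ?X twin_rels w"
      unfolding pres_gen_def using j w by (subst pres_group_mult) auto
    finally show ?case
      using gen[OF j, of "pres_class ?X twin_rels w"] Cons.IH w by (auto simp: pres_group_def)
  qed
  then show ?thesis using assms(1) by (auto simp: pres_group_def)
qed

text \<open>Here \<open>h\<close> is either \<open>\<iota>\<^sup>R\<close>, with \<open>k = m\<close>, or \<open>\<iota>\<^sup>L\<close>, with \<open>k = 0\<close>: it relabels the generators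
  so as to skip index \<open>k\<close>. Multiplying \<open>I + G X\<close> from the left by \<open>V\<^sub>i = I + G E\<close> replaces \<open>X\<close> by
  \<open>X + E + E G X\<close>. Since \<open>E\<close> is concentrated at \<open>(i, i)\<close> with \<open>i \<noteq> k\<close>, row and column \<open>k\<close> stay
  zero.\<close>

lemma stabilised_matrix:
  assumes \<beta>: "\<beta> \<in> carrier (twin_group (Suc m))"
    and h: "h \<in> hom (twin_group (Suc m)) (twin_group (Suc (Suc m)))"
    and h_gen: "\<And>j. j < m \<Longrightarrow>
      h (twin_gen (Suc m) (Suc j)) = twin_gen (Suc (Suc m)) (Suc (insert_index k j))"
    and k: "k = 0 \<or> k = m"
  shows "psi (Suc m) \<beta> = mat_delete (psi (Suc (Suc m)) (h \<beta>)) k k \<and>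
    (\<exists>X \<in> carrier_mat (Suc m) (Suc m).
      psi (Suc (Suc m)) (h \<beta>) = 1\<^sub>m (Suc m) + cartan (Suc m) * X \<and>
      (\<forall>l < Suc m. X $$ (k, l) = 0 \<and> X $$ (l, k) = 0))"
  using \<beta>
proof (induction rule: twin_group_induct)
  case one
  have "h \<one>\<^bsub>twin_group (Suc m)\<^esub> = \<one>\<^bsub>twin_group (Suc (Suc m))\<^esub>"
    by (rule hom_one[OF h pres_group_group pres_group_group])
  then show ?case
    using k by (auto simp: psi_one mat_delete_one intro!: bexI[of _ "0\<^sub>m (Suc m) (Suc m)"])
next
  case (gen j g)
  let ?N = "Suc m" and ?G = "cartan (Suc m)"
  from gen(1) obtain j' where j: "j = Suc j'" and j': "j' < m" by (cases j) auto
  define i where "i = insert_index k j'"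
  have i: "i < ?N" "i \<noteq> k" using j' by (auto simp: i_def insert_index_def)
  then have i': "Suc i \<in> {1..<Suc ?N}" by auto
  let ?V = "Vmat (Suc ?N) (Suc i)" and ?M = "psi (Suc ?N) (h g)"
  have V: "?V \<in> carrier_mat ?N ?N" using Vmat_carrier[of "Suc ?N" "Suc i"] by simp
  have hg: "h g \<in> carrier (twin_group (Suc ?N))" using hom_in_carrier[OF h gen(2)] .
  have M: "?M \<in> carrier_mat ?N ?N" using psi_carrier[OF hg] by simp
  from gen(3) obtain X where g: "psi (Suc m) g = mat_delete ?M k k"
    and X: "X \<in> carrier_mat ?N ?N" "?M = 1\<^sub>m ?N + ?G * X"
      "\<And>l. l < ?N \<Longrightarrow> X $$ (k, l) = 0" "\<And>l. l < ?N \<Longrightarrow> X $$ (l, k) = 0" by auto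
  have "h (twin_gen (Suc m) j \<otimes>\<^bsub>twin_group (Suc m)\<^esub> g)
      = twin_gen (Suc ?N) (Suc i) \<otimes>\<^bsub>twin_group (Suc ?N)\<^esub> h g"
    using hom_mult[OF h twin_gen_closed[OF gen(1)] gen(2)] h_gen[OF j'] by (simp add: i_def j)
  then have big: "psi (Suc ?N) (h (twin_gen (Suc m) j \<otimes>\<^bsub>twin_group (Suc m)\<^esub> g)) = ?V * ?M"
    using psi_mult[OF twin_gen_closed[OF i'] hg] psi_gen[OF i'] by simp
  have small: "psi (Suc m) (twin_gen (Suc m) j \<otimes>\<^bsub>twin_group (Suc m)\<^esub> g) = Vmat (Suc m) j * psi (Suc m) g"
    using psi_mult[OF twin_gen_closed[OF gen(1)] gen(2)] psi_gen[OF gen(1)] by simp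
  have "mat_delete ?V k k = Vmat (Suc m) j"
  proof (rule eq_matI)
    fix r c assume "r < dim_row (Vmat (Suc m) j)" "c < dim_col (Vmat (Suc m) j)"
    then have rc: "r < m" "c < m" by auto
    have "mat_delete ?V k k $$ (r, c) = ?V $$ (insert_index k r, insert_index k c)"
      using V rc k by (intro mat_delete_diag_index) auto
    also have "\<dots> = Vmat (Suc m) j $$ (r, c)"
      using k
    proof
      assume "k = 0"
      then show ?thesis using rc by (simp add: Vmat_def i_def j insert_index_def)
    next
      assume "k = m"
      then show ?thesis using j' rc by (simp add: Vmat_def i_def j insert_index_def)
    qed
    finally show "mat_delete ?V k k $$ (r, c) = Vmat (Suc m) j $$ (r, c)" .
  qed (use V in \<open>auto simp: mat_delete_def\<close>)
  moreover have "mat_delete (?V * ?M) k k = mat_delete ?V k k * mat_delete ?M k k"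
  proof (rule mat_delete_mult[OF V M])
    show "k < ?N" using k by auto
    fix r c assume "r < ?N" "r \<noteq> k"
    then show "?V $$ (r, k) * ?M $$ (k, c) = 0" using i k by (auto simp: Vmat_def)
  qed
  ultimately have del: "psi (Suc m) (twin_gen (Suc m) j \<otimes>\<^bsub>twin_group (Suc m)\<^esub> g) = mat_delete (?V * ?M) k k"
    using small g by simp
  let ?e = "unit_col ?N i"
  define E where "E = ?e * transpose_mat ?e"
  define G where "G = ?G"
  have G: "G \<in> carrier_mat ?N ?N" by (simp add: G_def)
  have E: "E \<in> carrier_mat ?N ?N" unfolding E_def by (rule mult_carrier_mat[of _ _ 1]) auto
  have GE: "G * E \<in> carrier_mat ?N ?N" by (rule mult_carrier_mat[OF G E])
  have EG: "E * G \<in> carrier_mat ?N ?N" by (rule mult_carrier_mat[OF E G])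
  have GX: "G * X \<in> carrier_mat ?N ?N" by (rule mult_carrier_mat[OF G X(1)])
  have EGX: "E * (G * X) \<in> carrier_mat ?N ?N" by (rule mult_carrier_mat[OF E GX])
  define Y where "Y = X + (E + E * (G * X))"
  have EY: "E + E * (G * X) \<in> carrier_mat ?N ?N" by (rule add_carrier_mat[OF EGX])
  have Y: "Y \<in> carrier_mat ?N ?N" unfolding Y_def by (rule add_carrier_mat[OF EY])
  have "?V * ?M = 1\<^sub>m ?N + G * Y"
  proof -
    have "?V = 1\<^sub>m ?N + G * E"
      using Vmat_reflection[OF i'] by (simp add: reflection_def G_def E_def)
    then have "?V * ?M = (1\<^sub>m ?N + G * X) + G * E * (1\<^sub>m ?N + G * X)"
      using add_mult_distrib_mat[OF one_carrier_mat GE, of "1\<^sub>m ?N + G * X" ?N] GX X(2)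
      by (simp add: G_def)
    also have "G * E * (1\<^sub>m ?N + G * X) = G * (E + E * (G * X))"
      using assoc_mult_mat[OF G E add_carrier_mat[OF GX, of "1\<^sub>m ?N"]]
        mult_add_distrib_mat[OF E one_carrier_mat GX] E by simp
    also have "(1\<^sub>m ?N + G * X) + \<dots> = 1\<^sub>m ?N + (G * X + G * (E + E * (G * X)))"
      by (rule assoc_add_mat[OF one_carrier_mat GX mult_carrier_mat[OF G EY]])
    also have "G * X + G * (E + E * (G * X)) = G * Y"
      unfolding Y_def by (rule mult_add_distrib_mat[OF G X(1) EY, symmetric])
    finally show ?thesis .
  qed
  moreover have "Y $$ (k, l) = 0 \<and> Y $$ (l, k) = 0" if l: "l < ?N" for l
  proof -
    have kN: "k < ?N" using k by auto
    have E0: "E $$ (k, c) = 0" "E $$ (c, k) = 0" if "c < ?N" for c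
    proof -
      have "E $$ (k, c) = ?e $$ (k, 0) * ?e $$ (c, 0)" "E $$ (c, k) = ?e $$ (c, 0) * ?e $$ (k, 0)"
        unfolding E_def using that kN by (auto intro!: outer_index)
      then show "E $$ (k, c) = 0" "E $$ (c, k) = 0" using i kN by (auto simp: unit_col_def)
    qed
    have "(E * (G * X)) $$ (k, l) = 0"
      using mult_index_zero_row[OF E GX kN l] E0 by simp
    moreover have "(E * G * X) $$ (l, k) = 0"
      using mult_index_zero_column[OF EG X(1) l kN] X(4) by simp
    then have "(E * (G * X)) $$ (l, k) = 0"
      using assoc_mult_mat[OF E G X(1)] by simp
    ultimately show ?thesis
      using E0[OF l] X(3,4)[OF l] E X(1) EGX kN l by (simp add: Y_def del: index_mult_mat(1))
  qed
  ultimately show ?case using Y unfolding big del G_def by (intro conjI bexI[of _ Y]) auto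
qed

text \<open>This covers both parts of the theorem. The factor \<open>a\<^sub>k\<^sup>2\<close> arises because the reflection vector
  \<open>a\<close> enters \<open>det (X + v a\<^sup>T)\<close> only through the product \<open>v\<^sub>k a\<^sub>k\<close>.\<close>

lemma finv_stabilise:
  assumes m: "m > 0"
    and \<beta>: "\<beta> \<in> carrier (twin_group (Suc m))"
    and h: "h \<in> hom (twin_group (Suc m)) (twin_group (Suc (Suc m)))"
    and h_gen: "\<And>j. j < m \<Longrightarrow>
      h (twin_gen (Suc m) (Suc j)) = twin_gen (Suc (Suc m)) (Suc (insert_index k j))"
    and k: "k = 0 \<or> k = m"
    and \<tau>: "\<tau> \<in> carrier (twin_group (Suc (Suc m)))"
    and a: "a \<in> carrier_mat (Suc m) 1" and \<tau>_refl: "psi (Suc (Suc m)) \<tau> = reflection (Suc m) a"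
  shows "finv (Suc (Suc m)) (h \<beta> \<otimes>\<^bsub>twin_group (Suc (Suc m))\<^esub> \<tau>) = (a $$ (k, 0))\<^sup>2 * finv (Suc m) \<beta>"
proof -
  let ?N = "Suc m" and ?G' = "cartan m"
  define G where "G = cartan ?N"
  define P where "P = a * transpose_mat a"
  let ?M = "psi (Suc ?N) (h \<beta>)"
  from stabilised_matrix[OF \<beta> h h_gen k] obtain X where small: "psi (Suc m) \<beta> = mat_delete ?M k k"
    and X: "X \<in> carrier_mat ?N ?N" "?M = 1\<^sub>m ?N + G * X"
      "\<And>l. l < ?N \<Longrightarrow> X $$ (k, l) = 0" "\<And>l. l < ?N \<Longrightarrow> X $$ (l, k) = 0"
    by (auto simp: G_def)
  let ?X' = "mat_delete X k k"
  have kN: "k < ?N" using k by auto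
  have X': "?X' \<in> carrier_mat m m" using X(1) by (auto simp: mat_delete_def)
  have G: "G \<in> carrier_mat ?N ?N" by (simp add: G_def)
  have ta: "transpose_mat a \<in> carrier_mat 1 ?N" using a by simp
  have P: "P \<in> carrier_mat ?N ?N" unfolding P_def by (rule mult_carrier_mat[OF a ta])
  have Ga: "G * a \<in> carrier_mat ?N 1" by (rule mult_carrier_mat[OF G a])
  have GP: "G * P \<in> carrier_mat ?N ?N" by (rule mult_carrier_mat[OF G P])
  have GX: "G * X \<in> carrier_mat ?N ?N" by (rule mult_carrier_mat[OF G X(1)])
  have XGa: "X * (G * a) \<in> carrier_mat ?N 1" by (rule mult_carrier_mat[OF X(1) Ga])
  have XGP: "X * (G * P) \<in> carrier_mat ?N ?N" by (rule mult_carrier_mat[OF X(1) GP])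
  define v where "v = a + X * (G * a)"
  have v: "v \<in> carrier_mat ?N 1" unfolding v_def by (rule add_carrier_mat[OF XGa])
  have va: "v * transpose_mat a \<in> carrier_mat ?N ?N" by (rule mult_carrier_mat[OF v ta])
  have vk: "v $$ (k, 0) = a $$ (k, 0)"
  proof -
    have "(X * (G * a)) $$ (k, 0) = 0"
      using mult_index_zero_row[OF X(1) Ga kN] X(3) by simp
    then show ?thesis
      using index_add_mat(1)[of k "X * (G * a)" 0 a] XGa a kN
      by (simp add: v_def carrier_matD[OF XGa] del: index_mult_mat)
  qed
  have outer: "P + X * (G * P) = v * transpose_mat a"
  proof -
    have "X * (G * P) = X * (G * a) * transpose_mat a"
      using assoc_mult_mat[OF G a ta] assoc_mult_mat[OF X(1) Ga ta] by (simp add: P_def)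
    then show ?thesis
      using add_mult_distrib_mat[OF a XGa ta] by (simp add: v_def P_def)
  qed
  have "?M * reflection ?N a = (1\<^sub>m ?N + G * P) + G * X * (1\<^sub>m ?N + G * P)"
    using add_mult_distrib_mat[OF one_carrier_mat GX, of "1\<^sub>m ?N + G * P" ?N] GP X(2)
    by (simp add: reflection_def G_def P_def)
  also have "G * X * (1\<^sub>m ?N + G * P) = G * (X + X * (G * P))"
    using assoc_mult_mat[OF G X(1) add_carrier_mat[OF GP, of "1\<^sub>m ?N"]]
      mult_add_distrib_mat[OF X(1) one_carrier_mat GP] X(1) by simp
  also have "(1\<^sub>m ?N + G * P) + \<dots> = 1\<^sub>m ?N + (G * P + G * (X + X * (G * P)))"
    by (rule assoc_add_mat[OF one_carrier_mat GP mult_carrier_mat[OF G add_carrier_mat[OF XGP]]])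
  also have "G * P + G * (X + X * (G * P)) = G * (P + (X + X * (G * P)))"
    by (rule mult_add_distrib_mat[OF G P add_carrier_mat[OF XGP], symmetric])
  also have "P + (X + X * (G * P)) = X + v * transpose_mat a"
    unfolding outer[symmetric] using P X(1) XGP
    by (intro eq_matI) (auto simp: algebra_simps simp del: index_mult_mat(1))
  finally have prod: "?M * reflection ?N a = 1\<^sub>m ?N + G * (X + v * transpose_mat a)" .
  have hb: "h \<beta> \<in> carrier (twin_group (Suc ?N))" using hom_in_carrier[OF h \<beta>] .
  have S: "X + v * transpose_mat a \<in> carrier_mat ?N ?N" by (rule add_carrier_mat[OF va])
  have minus: "(1\<^sub>m l + Z) - 1\<^sub>m l = Z" if "Z \<in> carrier_mat l l" for l and Z :: "ratfun mat"
    using that by (intro eq_matI) auto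
  have "psi (Suc ?N) (h \<beta> \<otimes>\<^bsub>twin_group (Suc ?N)\<^esub> \<tau>) - 1\<^sub>m ?N = G * (X + v * transpose_mat a)"
    using psi_mult[OF hb \<tau>] \<tau>_refl prod minus[OF mult_carrier_mat[OF G S]] by simp
  then have "det (psi (Suc ?N) (h \<beta> \<otimes>\<^bsub>twin_group (Suc ?N)\<^esub> \<tau>) - 1\<^sub>m ?N)
      = det G * det (X + v * transpose_mat a)"
    using det_mult[OF G S] by simp
  also have "det (X + v * transpose_mat a) = (a $$ (k, 0))\<^sup>2 * det ?X'"
    using det_padded_plus_outer[OF X(1) v a kN X(3,4)] vk by (simp add: power2_eq_square)
  finally have big: "det (psi (Suc ?N) (h \<beta> \<otimes>\<^bsub>twin_group (Suc ?N)\<^esub> \<tau>) - 1\<^sub>m ?N)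
    = det (cartan ?N) * ((a $$ (k, 0))\<^sup>2 * det ?X')" by (simp add: G_def)
  have "psi (Suc m) \<beta> - 1\<^sub>m m = mat_delete (G * X) k k"
    unfolding small X(2) by (rule mat_delete_one_plus[OF GX kN])
  also have "\<dots> = mat_delete G k k * ?X'"
    using X(3) by (intro mat_delete_mult[OF G X(1) kN]) simp
  also have "mat_delete G k k = ?G'" unfolding G_def by (rule mat_delete_cartan[OF k])
  finally have "det (psi (Suc m) \<beta> - 1\<^sub>m m) = det ?G' * det ?X'"
    using det_mult[of ?G' m ?X'] X' by simp
  then show ?thesis
    using big m det_cartan_nonzero[of "Suc m"] det_cartan_nonzero[of m]
    by (simp add: finv_def det_cartan_cheb[symmetric] del: power_Suc)
qed

theorem lemma4p9:
  fixes n i :: nat and \<beta> :: "nat word set"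
  assumes "n \<ge> 3" and "\<beta> \<in> carrier (twin_group n)" and "1 \<le> i" and "i \<le> n - 1"
  shows "finv (n + 1) (iotaR n \<beta> \<otimes>\<^bsub>twin_group (n + 1)\<^esub> twin_R n i) = xvar ^ (2 * i) * finv n \<beta>
    \<and> finv (n + 1) (iotaL n \<beta> \<otimes>\<^bsub>twin_group (n + 1)\<^esub> twin_L n i) = xvar ^ (2 * i) * finv n \<beta>"
proof -
  obtain m where n: "n = Suc m" and m: "m > 0" using assms(1) by (cases n) auto
  have i: "i \<le> m" using assms(4) n by simp
  have \<beta>: "\<beta> \<in> carrier (twin_group (Suc m))" using assms(2) n by simp

  have "n - i + 1 = m - i + 2" "n - i = m - i + 1" "n + 1 = m - i + i + 2" using i n by simp_all
  then have "twin_R n i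
      = twin_prod (n + 1) (rev [m - i + 2..<m - i + i + 2] @ [m - i + 1] @ [m - i + 2..<m - i + i + 2])"
    unfolding twin_R_def by (simp only:)
  then have "\<exists>a \<in> carrier_mat (Suc m) 1.
      psi (Suc (Suc m)) (twin_R n i) = reflection (Suc m) a \<and> a $$ (m, 0) = xvar ^ i"
    using psi_palindrome_up[of "m - i" i "Suc m"] i by (simp add: n One_nat_def del: upt_Suc)
  then obtain a where a: "a \<in> carrier_mat (Suc m) 1"
    "psi (Suc (Suc m)) (twin_R n i) = reflection (Suc m) a" "a $$ (m, 0) = xvar ^ i" by auto
  have closedR: "twin_R n i \<in> carrier (twin_group (Suc (Suc m)))"
    unfolding twin_R_def n Suc_eq_plus1[symmetric] using i by (intro twin_prod_closed) auto
  have genR: "iotaR (Suc m) (twin_gen (Suc m) (Suc j)) = twin_gen (Suc (Suc m)) (Suc (insert_index m j))"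
    if "j < m" for j
    using iotaR_gen[of "Suc j" "Suc m"] that by (simp add: insert_index_def One_nat_def)
  have homR: "iotaR (Suc m) \<in> hom (twin_group (Suc m)) (twin_group (Suc (Suc m)))"
    using iotaR_hom[of "Suc m"] by (simp add: One_nat_def)
  have R: "finv (n + 1) (iotaR n \<beta> \<otimes>\<^bsub>twin_group (n + 1)\<^esub> twin_R n i) = xvar ^ (2 * i) * finv n \<beta>"
    using finv_stabilise[OF m \<beta> homR genR _ closedR a(1,2)] a(3)
    by (simp add: n power_mult[symmetric] mult.commute One_nat_def)

  have "\<exists>b \<in> carrier_mat (Suc m) 1.
      psi (Suc (Suc m)) (twin_L n i) = reflection (Suc m) b \<and> b $$ (0, 0) = xvar ^ i"
    using psi_palindrome_down[of i "Suc m" i] i by (auto simp: twin_L_def n One_nat_def)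
  then obtain b where b: "b \<in> carrier_mat (Suc m) 1"
    "psi (Suc (Suc m)) (twin_L n i) = reflection (Suc m) b" "b $$ (0, 0) = xvar ^ i" by auto
  have closedL: "twin_L n i \<in> carrier (twin_group (Suc (Suc m)))"
    unfolding twin_L_def n Suc_eq_plus1[symmetric] using i by (intro twin_prod_closed) auto
  have genL: "iotaL (Suc m) (twin_gen (Suc m) (Suc j)) = twin_gen (Suc (Suc m)) (Suc (insert_index 0 j))"
    if "j < m" for j
    using iotaL_gen[of "Suc j" "Suc m"] that by (simp add: insert_index_def One_nat_def)
  have homL: "iotaL (Suc m) \<in> hom (twin_group (Suc m)) (twin_group (Suc (Suc m)))"
    using iotaL_hom[of "Suc m"] by (simp add: One_nat_def)
  have L: "finv (n + 1) (iotaL n \<beta> \<otimes>\<^bsub>twin_group (n + 1)\<^esub> twin_L n i) = xvar ^ (2 * i) * finv n \<beta>"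
    using finv_stabilise[OF m \<beta> homL genL _ closedL b(1,2)] b(3)
    by (simp add: n power_mult[symmetric] mult.commute One_nat_def)

  show ?thesis using R L by blast
qed

end
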